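(* For every odd integer $n\ge 3$, there exists a pair of orthogonal Latin squares $A=(a_{ij})$, $B=(b_{ij})$ of order $n$ such that each of $A$ and $B$ has main diagonal sum $n(n+1)/2$ and antidiagonal sum $n(n+1)/2$; that is, $\sum_{i=1}^n a_{ii}=\sum_{i=1}^n b_{ii}=\sum_{i=1}^n a_{i(n+1-i)}=\sum_{i=1}^n b_{i(n+1-i)}=\frac{n(n+1)}{2}$.
   Context: A Latin square of order $n$ is an $n\times n$ array with entries in $\{1,\dots,n\}$ in which each symbol occurs exactly once in each row and each column. Two Latin squares $(a_{ij})$, $(b_{ij})$ of order $n$ are orthogonal if the $n^2$ ordered pairs $(a_{ij},b_{ij})$ are all distinct. *)

theory Defs
  imports Main
begin

(* An n x n array is a function of the row and column index, of which only the
   values at indices in {1..n} matter. *)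

definition latin_square :: "nat \<Rightarrow> (nat \<Rightarrow> nat \<Rightarrow> nat) \<Rightarrow> bool" where
  "latin_square n A \<longleftrightarrow>
     (\<forall>i\<in>{1..n}. \<forall>j\<in>{1..n}. A i j \<in> {1..n}) \<and>
     (\<forall>i\<in>{1..n}. \<forall>s\<in>{1..n}. \<exists>!j. j \<in> {1..n} \<and> A i j = s) \<and>
     (\<forall>j\<in>{1..n}. \<forall>s\<in>{1..n}. \<exists>!i. i \<in> {1..n} \<and> A i j = s)"

definition orthogonal_squares ::
  "nat \<Rightarrow> (nat \<Rightarrow> nat \<Rightarrow> nat) \<Rightarrow> (nat \<Rightarrow> nat \<Rightarrow> nat) \<Rightarrow> bool" where
  "orthogonal_squares n A B \<longleftrightarrow>
     inj_on (\<lambda>(i, j). (A i j, B i j)) ({1..n} \<times> {1..n})"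

end

theory Submission
  imports Defs "HOL-Number_Theory.Cong"
begin

text \<open>
  For \<open>n = 2 m + 1\<close>, reduce \<open>i + j\<close> and \<open>i - j\<close> modulo \<open>n\<close>. Since 2 is invertible modulo \<open>n\<close>, the two
  cyclic squares are orthogonal, and each of them has one diagonal that is a permutation of the
  symbols and one that is constant. A shift of the symbols makes the constant the middle symbol
  \<open>m + 1\<close>, so that all four diagonals have the same sum.
\<close>

text \<open>The argument is an integer so that differences of indices are not truncated; adding 1
  moves the residues 0, ..., n - 1 to the symbols.\<close>

definition symbol :: "nat \<Rightarrow> int \<Rightarrow> nat" where
  "symbol n x = nat (x mod int n) + 1"

lemma symbol_in_range: "n > 0 \<Longrightarrow> symbol n x \<in> {1..n}"
  by (simp add: symbol_def Suc_le_eq nat_less_iff)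

lemma symbol_eq_iff: "n > 0 \<Longrightarrow> symbol n x = symbol n y \<longleftrightarrow> [x = y] (mod int n)"
  by (simp add: symbol_def cong_def eq_nat_nat_iff)

text \<open>Two indices differ by less than \<open>n\<close>, so a difference divisible by
  \<open>n\<close> is zero.\<close>

lemma cong_int_imp_eq:
  fixes a b n :: nat
  assumes "[int a = int b] (mod int n)" "a \<in> {1..n}" "b \<in> {1..n}"
  shows "a = b"
proof -
  have "int n dvd int a - int b"
    using assms(1) by (simp add: cong_iff_dvd_diff)
  moreover have "\<bar>int a - int b\<bar> < int n"
    using assms(2,3) by auto
  ultimately show ?thesis
    using dvd_imp_le_int[of "int a - int b" "int n"] by fastforce
qed

text \<open>An injective self-map of a finite set is surjective, so each symbol is attained as soon
  as no symbol repeats.\<close>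

lemma latin_squareI:
  assumes range: "\<And>i j. i \<in> {1..n} \<Longrightarrow> j \<in> {1..n} \<Longrightarrow> A i j \<in> {1..n}"
    and row: "\<And>i. i \<in> {1..n} \<Longrightarrow> inj_on (\<lambda>j. A i j) {1..n}"
    and col: "\<And>j. j \<in> {1..n} \<Longrightarrow> inj_on (\<lambda>i. A i j) {1..n}"
  shows "latin_square n A"
proof -
  have unique: "\<exists>!x. x \<in> {1..n} \<and> f x = s"
    if "inj_on f {1..n}" "f ` {1..n} \<subseteq> {1..n}" "s \<in> {1..n}" for f :: "nat \<Rightarrow> nat" and s
  proof -
    have "f ` {1..n} = {1..n}"
      using that(1,2) by (intro endo_inj_surj) auto
    with that(3) obtain x where "x \<in> {1..n}" "f x = s"
      by (metis imageE)
    with that(1) show ?thesis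
      by (metis inj_onD)
  qed
  show ?thesis
    unfolding latin_square_def
    by (intro conjI ballI unique row col range image_subsetI)
qed

lemma sum_inj_on_endo:
  fixes f :: "nat \<Rightarrow> nat"
  assumes "inj_on f {1..n}" "\<And>i. i \<in> {1..n} \<Longrightarrow> f i \<in> {1..n}"
  shows "(\<Sum>i=1..n. f i) = n * (n + 1) div 2"
proof -
  have "f ` {1..n} = {1..n}"
    using assms by (intro endo_inj_surj) auto
  then have "(\<Sum>i=1..n. f i) = \<Sum>{1..n}"
    using sum.reindex[OF assms(1), of "\<lambda>x. x"] by simp
  also have "\<dots> = n * (n + 1) div 2"
    by (simp add: Sum_Icc_nat)
  finally show ?thesis .
qed

theorem theorem4p3:
  fixes n :: nat
  assumes "odd n" and "n \<ge> 3"
  shows "\<exists>A B :: nat \<Rightarrow> nat \<Rightarrow> nat.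
    latin_square n A \<and> latin_square n B \<and> orthogonal_squares n A B \<and>
    (\<Sum>i=1..n. A i i) = n * (n + 1) div 2 \<and>
    (\<Sum>i=1..n. B i i) = n * (n + 1) div 2 \<and>
    (\<Sum>i=1..n. A i (n + 1 - i)) = n * (n + 1) div 2 \<and>
    (\<Sum>i=1..n. B i (n + 1 - i)) = n * (n + 1) div 2"
proof -
  obtain m where m: "n = 2 * m + 1"
    using assms(1) by (auto elim: oddE)
  have n: "n > 0"
    using m by simp
  \<comment> \<open>The shifts differ because the constant diagonals do: i + j = n + 1 is 1 modulo n
    on the antidiagonal, i - j = 0 on the main diagonal. Both then give residue m.\<close>
  define A where "A i j = symbol n (int i + int j + (int m - 1))" for i j
  define B where "B i j = symbol n (int i - int j + int m)" for i j
  have A_eq: "A i j = A k l \<longleftrightarrow> [int i + int j = int k + int l] (mod int n)" for i j k l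
    unfolding A_def symbol_eq_iff[OF n] by (rule cong_add_rcancel)
  have B_eq: "B i j = B k l \<longleftrightarrow> [int i - int j = int k - int l] (mod int n)" for i j k l
    unfolding B_def symbol_eq_iff[OF n] by (rule cong_add_rcancel)
  have A_range: "A i j \<in> {1..n}" and B_range: "B i j \<in> {1..n}" for i j
    unfolding A_def B_def by (rule symbol_in_range[OF n])+
  \<comment> \<open>This is where oddness enters: 2 can be cancelled modulo n. Orthogonality and
    both non-constant diagonals rest on it.\<close>
  have double: "a = b"
    if "[2 * int a = 2 * int b] (mod int n)" "a \<in> {1..n}" "b \<in> {1..n}" for a b
  proof -
    have "coprime (2 :: int) (int n)"
      using assms(1) by simp
    then have "[int a = int b] (mod int n)"
      using that(1) by (simp add: cong_mult_lcancel)
    then show ?thesis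
      using that(2,3) by (rule cong_int_imp_eq)
  qed
  have "latin_square n A"
    by (intro latin_squareI A_range inj_onI)
      (auto simp: A_eq cong_add_lcancel cong_add_rcancel intro: cong_int_imp_eq)
  moreover have "latin_square n B"
    by (intro latin_squareI B_range inj_onI; rule cong_int_imp_eq)
      \<comment> \<open>Along a row the column index enters with a minus sign, so the difference has
        to be reversed.\<close>
      (auto simp: B_eq cong_iff_dvd_diff dvd_diff_commute)
  moreover have "orthogonal_squares n A B"
    unfolding orthogonal_squares_def
  proof (rule inj_onI, clarify)
    fix i j k l
    assume mem: "i \<in> {1..n}" "j \<in> {1..n}" "k \<in> {1..n}" "l \<in> {1..n}"
      and eq: "A i j = A k l" "B i j = B k l"
    \<comment> \<open>Add and subtract the congruences for i + j and i - j.\<close>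
    have "[2 * int i = 2 * int k] (mod int n)" "[2 * int j = 2 * int l] (mod int n)"
      using cong_add[OF eq[unfolded A_eq B_eq]] cong_diff[OF eq[unfolded A_eq B_eq]]
      by simp_all
    then show "i = k \<and> j = l"
      using mem double by blast
  qed
  moreover have "(\<Sum>i=1..n. A i i) = n * (n + 1) div 2"
    by (intro sum_inj_on_endo A_range inj_onI double) (simp_all add: A_eq flip: mult_2)
  \<comment> \<open>Every term is m + 1, and n + 1 = 2 (m + 1).\<close>
  moreover have "(\<Sum>i=1..n. B i i) = n * (n + 1) div 2"
    using m by (simp add: B_def symbol_def)
  moreover have "(\<Sum>i=1..n. A i (n + 1 - i)) = n * (n + 1) div 2"
  proof -
    have "A i (n + 1 - i) = m + 1" if "i \<in> {1..n}" for i
    proof -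
      have "int i + int (n + 1 - i) + (int m - 1) = int m + int n"
        using that by auto
      then have "A i (n + 1 - i) = symbol n (int m + int n)"
        by (simp only: A_def)
      also have "\<dots> = m + 1"
        unfolding symbol_def mod_add_self2 using m by simp
      finally show ?thesis .
    qed
    then show ?thesis
      using m by simp
  qed
  moreover have "(\<Sum>i=1..n. B i (n + 1 - i)) = n * (n + 1) div 2"
  proof (intro sum_inj_on_endo B_range inj_onI double)
    fix i k
    assume mem: "i \<in> {1..n}" "k \<in> {1..n}" and eq: "B i (n + 1 - i) = B k (n + 1 - k)"
    \<comment> \<open>The natural subtraction is exact for i \<le> n; the common constant n + 1 then
      cancels.\<close>
    have "int i - int (n + 1 - i) = 2 * int i - (int n + 1)"
      "int k - int (n + 1 - k) = 2 * int k - (int n + 1)"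
      using mem by auto
    then show "[2 * int i = 2 * int k] (mod int n)"
      using eq by (simp add: B_eq cong_iff_dvd_diff)
  qed
  ultimately show ?thesis
    by blast
qed

end
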